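(* Let $G\in\{C_8(1,2,4),\,C_8(1,3,4),\,C_8(1,2,3)\}$. For every $k\ge 3$, $\chi_{la}(G\vee O_k)=5$.
   Context: The circulant graph $C_n(1,a_1,\dots,a_t)$ has vertex set $\mathbb{Z}_n$, with $i,j$ adjacent iff their cyclic distance $\min(|i-j|,n-|i-j|)$ lies in $\{1,a_1,\dots,a_t\}$. $O_k$ is the edgeless graph on $k$ vertices, and the join $G\vee H$ of vertex-disjoint graphs has vertex set $V(G)\cup V(H)$ and edge set $E(G)\cup E(H)\cup\{uv:u\in V(G),v\in V(H)\}$. For a simple graph with $q$ edges, a bijection $f:E\to\{1,\dots,q\}$ is a local antimagic labeling if $f^+(u)\neq f^+(v)$ for every edge $uv$, where $f^+(u)=\sum_{e\ni u} f(e)$; $\chi_{la}$ is the minimum number of distinct values of $f^+$ over all local antimagic labelings. *)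

theory Defs
  imports "HOL-Library.Extended_Nat"
begin

type_synonym 'a graph = "'a set \<times> 'a set set"

abbreviation verts :: "'a graph \<Rightarrow> 'a set" where "verts \<equiv> fst"
abbreviation edges :: "'a graph \<Rightarrow> 'a set set" where "edges \<equiv> snd"

definition simple_graph :: "'a graph \<Rightarrow> bool" where
  "simple_graph G \<longleftrightarrow>
     finite (verts G) \<and> (\<forall>e \<in> edges G. e \<subseteq> verts G \<and> card e = 2)"

definition cyclic_dist :: "int \<Rightarrow> int \<Rightarrow> int \<Rightarrow> int" where
  "cyclic_dist n i j = min \<bar>i - j\<bar> (n - \<bar>i - j\<bar>)"

text \<open>The residues modulo \<open>n\<close> are represented by \<open>{0..<n}\<close>; the connection set \<open>D\<close> is meant to
  consist of positive integers (otherwise loops arise).\<close>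

definition circulant :: "int \<Rightarrow> int set \<Rightarrow> int graph" where
  "circulant n D =
     ({0..<n}, {{i, j} | i j. i \<in> {0..<n} \<and> j \<in> {0..<n} \<and> cyclic_dist n i j \<in> D})"

definition edgeless :: "nat \<Rightarrow> nat graph" where
  "edgeless k = ({0..<k}, {})"

text \<open>The sum type makes the vertex sets of the two graphs disjoint.\<close>

definition graph_join :: "'a graph \<Rightarrow> 'b graph \<Rightarrow> ('a + 'b) graph" where
  "graph_join G H =
     (Inl ` verts G \<union> Inr ` verts H,
      (`) Inl ` edges G \<union> (`) Inr ` edges H \<union> {{Inl u, Inr v} | u v. u \<in> verts G \<and> v \<in> verts H})"

definition vertex_sum :: "'a graph \<Rightarrow> ('a set \<Rightarrow> nat) \<Rightarrow> 'a \<Rightarrow> nat" where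
  "vertex_sum G f u = (\<Sum>e \<in> {e \<in> edges G. u \<in> e}. f e)"

definition local_antimagic :: "'a graph \<Rightarrow> ('a set \<Rightarrow> nat) \<Rightarrow> bool" where
  "local_antimagic G f \<longleftrightarrow>
     bij_betw f (edges G) {1..card (edges G)} \<and>
     (\<forall>u v. {u, v} \<in> edges G \<longrightarrow> vertex_sum G f u \<noteq> vertex_sum G f v)"

text \<open>Taken in \<open>enat\<close>, the infimum is attained whenever a local antimagic labeling exists, and is
  \<open>\<infinity>\<close> if there is none.\<close>

definition chi_la :: "'a graph \<Rightarrow> enat" where
  "chi_la G = (INF f \<in> {f. local_antimagic G f}. enat (card (vertex_sum G f ` verts G)))"

lemma simple_graph_circulant:
  assumes "\<And>d. d \<in> D \<Longrightarrow> d > 0"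
  shows "simple_graph (circulant n D)"
proof -
  have "card {i, j} = 2" if "cyclic_dist n i j \<in> D" "i \<in> {0..<n}" for i j
    using assms[OF that(1)] that(2) by (cases "i = j") (auto simp: cyclic_dist_def)
  then show ?thesis by (auto simp: simple_graph_def circulant_def)
qed

lemma simple_graph_edgeless: "simple_graph (edgeless k)"
  by (simp add: simple_graph_def edgeless_def)

lemma simple_graph_join:
  assumes "simple_graph G" "simple_graph H"
  shows "simple_graph (graph_join G H)"
  using assms unfolding simple_graph_def graph_join_def by (fastforce simp: card_image)

end

theory Submission
  imports Defs
begin

text \<open>
  Each of the three graphs \<open>G\<close> has 8 vertices and independence number 2, so a local antimagic
  labeling takes at least four values on \<open>G\<close>, and a further one on \<open>O\<^sub>k\<close>. For the converse, \<open>G\<close>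
  receives the smallest labels \<open>1, \<dots>, m\<close>, arranged (by a computer search) so that the
  vertices fall into four independent pairs of equal sum. The remaining labels, centred and doubled,
  are the odd integers of absolute value below \<open>8k\<close>. They are put into an \<open>8 \<times> k\<close> array with zero
  column sums whose row sums vanish for even \<open>k\<close>, and for odd \<open>k\<close>, where this is impossible by
  parity, are \<open>1\<close> on two of the pairs and \<open>-1\<close> on the other two. Such arrays grow by two columns
  at a time, starting from \<open>k = 0\<close> and \<open>k = 3\<close>.
\<close>

section \<open>Balanced arrays\<close>

text \<open>Meant for eight rows: there are exactly \<open>8 * k\<close> odd integers of absolute
  value below \<open>8 * k\<close>, so injectivity makes the array use each of them once. For odd
  \<open>k\<close> every row sum is odd, hence nonzero; since the total is zero, \<open>1\<close>
  and \<open>-1\<close> must occur equally often, so \<open>P\<close> should contain half of the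
  rows.\<close>

definition balanced_array :: "'a set \<Rightarrow> 'a set \<Rightarrow> nat \<Rightarrow> ('a \<Rightarrow> nat \<Rightarrow> int) \<Rightarrow> bool" where
  "balanced_array V P k M \<longleftrightarrow>
     inj_on (\<lambda>(v, j). M v j) (V \<times> {..<k}) \<and>
     (\<forall>v\<in>V. \<forall>j<k. odd (M v j) \<and> \<bar>M v j\<bar> < 8 * int k) \<and>
     (\<forall>j<k. (\<Sum>v\<in>V. M v j) = 0) \<and>
     (\<forall>v\<in>V. (\<Sum>j<k. M v j) = (if even k then 0 else if v \<in> P then 1 else -1))"

lemma balanced_array_reindex:
  assumes M: "balanced_array W Q k M" and h: "bij_betw h V W"
    and Q: "\<And>v. v \<in> V \<Longrightarrow> h v \<in> Q \<longleftrightarrow> v \<in> P"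
  shows "balanced_array V P k (\<lambda>v. M (h v))"
proof -
  have hV: "h v \<in> W" if "v \<in> V" for v
    using h that by (auto simp: bij_betw_def)
  have "inj_on (\<lambda>(v, j). M (h v) j) (V \<times> {..<k})"
  proof (rule inj_onI, clarsimp)
    fix u i v j
    assume *: "u \<in> V" "i < k" "v \<in> V" "j < k" "M (h u) i = M (h v) j"
    have "inj_on (\<lambda>(v, j). M v j) (W \<times> {..<k})"
      using M by (simp add: balanced_array_def)
    from inj_onD[OF this, of "(h u, i)" "(h v, j)"] have "h u = h v" "i = j"
      using * hV by auto
    then show "u = v \<and> i = j"
      using h * by (auto simp: bij_betw_def inj_on_def)
  qed
  moreover have "(\<Sum>v\<in>V. M (h v) j) = (\<Sum>w\<in>W. M w j)" for j
    by (rule sum.reindex_bij_betw[OF h])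
  ultimately show ?thesis
    using M hV Q by (auto simp: balanced_array_def)
qed

text \<open>Rows 4 to 7 negate rows 0 to 3, so the columns cancel. The absolute values in the first
  four rows are \<open>1, 3, ..., 23\<close>, each once.\<close>

abbreviation base_array :: "nat \<Rightarrow> nat \<Rightarrow> int" where
  "base_array i j \<equiv>
     [[23, -1, -21], [19, -3, -15], [-17, 7, 11], [-13, 5, 9],
      [-23, 1, 21], [-19, 3, 15], [17, -7, -11], [13, -5, -9]] ! i ! j"

lemma balanced_array_base: "balanced_array {..<8} {..<4} 3 base_array"
proof -
  have "inj_on (\<lambda>(v, j). base_array v j) ({..<8} \<times> {..<3})"
  proof -
    have "distinct (map (\<lambda>(v, j). base_array v j) (List.product [0..<8] [0..<3]))"
      by code_simp
    then have "inj_on (\<lambda>(v, j). base_array v j) (set (List.product [0..<8] [0..<3]))"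
      by (simp only: distinct_map)
    then show ?thesis
      by (simp only: set_product set_upt atLeast0LessThan)
  qed
  moreover have "\<forall>v\<in>{..<8}. \<forall>j<3. odd (base_array v j) \<and> \<bar>base_array v j\<bar> < 8 * int 3"
  proof -
    have "\<forall>v\<in>set [0..<8]. \<forall>j\<in>set [0..<3]. odd (base_array v j) \<and> \<bar>base_array v j\<bar> < 8 * int 3"
      by code_simp
    then show ?thesis by simp
  qed
  moreover have "\<forall>j<3. (\<Sum>v<8. base_array v j) = 0"
    by (simp add: eval_nat_numeral less_Suc_eq lessThan_Suc)
  moreover have "\<forall>v\<in>{..<8}. (\<Sum>j<3. base_array v j) = (if v \<in> {..<4} then 1 else -1)"
    by (simp add: eval_nat_numeral less_Suc_eq lessThan_Suc)
  ultimately show ?thesis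
    by (simp add: balanced_array_def)
qed

abbreviation thue_morse_sign :: "nat \<Rightarrow> int" where
  "thue_morse_sign i \<equiv> [1, -1, -1, 1, -1, 1, 1, -1] ! i"

text \<open>The two new columns use the absolute values \<open>8k + 1, 8k + 3, \<dots>, 8k + 15\<close>, once with either
  sign in each row; the signs \<open>+--+-++-\<close> annihilate every arithmetic progression.\<close>

lemma balanced_array_step:
  assumes M: "balanced_array {..<8} P k M"
  defines "c \<equiv> \<lambda>i. thue_morse_sign i * (8 * int k + 2 * int i + 1)"
  shows "balanced_array {..<8} P (k + 2)
           (\<lambda>i j. if j < k then M i j else if j = k then c i else - c i)"
    (is "balanced_array _ _ _ ?N")
proof -
  have sgn: "thue_morse_sign i = 1 \<or> thue_morse_sign i = -1" if "i < 8" for i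
    using that by (auto simp: eval_nat_numeral less_Suc_eq)
  have abs_c: "\<bar>c i\<bar> = 8 * int k + 2 * int i + 1" if "i < 8" for i
    using sgn[OF that] by (auto simp: c_def)
  have c_odd: "odd (c i)" if "i < 8" for i
    using sgn[OF that] by (auto simp: c_def)
  have small: "\<bar>M i j\<bar> < 8 * int k" if "i < 8" "j < k" for i j
    using M that by (auto simp: balanced_array_def)
  have new: "\<bar>?N i j\<bar> = 8 * int k + 2 * int i + 1" if "i < 8" "\<not> j < k" for i j
    using that abs_c by auto
  have "inj_on (\<lambda>(i, j). ?N i j) ({..<8} \<times> {..<k + 2})"
  proof (rule inj_onI, unfold split_paired_all mem_Sigma_iff prod.inject case_prod_conv, elim conjE)
    fix i j i' j'
    assume i: "i \<in> {..<8::nat}" "i' \<in> {..<8::nat}" and j: "j \<in> {..<k + 2}" "j' \<in> {..<k + 2}"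
      and eq: "?N i j = ?N i' j'"
    \<comment> \<open>The absolute value tells old entries from new ones, so a collision cannot mix
      the two kinds.\<close>
    have old_iff: "j < k \<longleftrightarrow> \<bar>?N i j\<bar> < 8 * int k" if "i < 8" for i j :: nat
      using small[OF that, of j] new[OF that, of j] by (cases "j < k") simp_all
    have "j < k \<longleftrightarrow> j' < k"
      using old_iff[of i j] old_iff[of i' j'] i by (simp only: eq lessThan_iff)
    then consider "j < k" "j' < k" | "\<not> j < k" "\<not> j' < k" by blast
    then show "i = i' \<and> j = j'"
    proof cases
      case 1
      have "inj_on (\<lambda>(v, j). M v j) ({..<8} \<times> {..<k})"
        using M by (simp add: balanced_array_def)
      from inj_onD[OF this, of "(i, j)" "(i', j')"] show ?thesis
        using 1 i eq by simp
    next
      case 2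
      \<comment> \<open>Among new entries the absolute value fixes the row; the sign then fixes the
        column because \<open>c i\<close> is nonzero.\<close>
      have "i = i'"
        using new[of i j] new[of i' j'] 2 i eq by simp
      moreover have "c i \<noteq> - c i"
        using abs_c[of i] i by auto
      then have "j = j'"
        using eq 2 j \<open>i = i'\<close> by (auto split: if_splits)
      ultimately show ?thesis by simp
    qed
  qed
  moreover have "odd (?N i j) \<and> \<bar>?N i j\<bar> < 8 * int (k + 2)" if "i < 8" "j < k + 2" for i j
  proof (cases "j < k")
    case True
    have "odd (M i j)"
      using M that True by (simp add: balanced_array_def)
    then show ?thesis
      using small[OF that(1) True] True by simp
  next
    case False
    then show ?thesis
      using new[OF that(1) False] c_odd[OF that(1)] that by simp
  qed
  moreover have "(\<Sum>i<8. c i) = 0"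
    by (simp add: c_def eval_nat_numeral lessThan_Suc)
  then have "(\<Sum>i<8. ?N i j) = 0" if "j < k + 2" for j
    using M by (cases "j < k"; cases "j = k") (auto simp: balanced_array_def sum_negf)
  \<comment> \<open>The new columns cancel in each row and \<open>k + 2\<close> has the parity of
    \<open>k\<close>, so the prescribed row sums persist.\<close>
  moreover have "(\<Sum>j<k + 2. ?N i j) = (\<Sum>j<k. M i j)" for i
    by simp
  ultimately show ?thesis
    using M unfolding balanced_array_def by simp
qed

text \<open>For \<open>k = 1\<close> the row sums would be the entries themselves and
  \<open>1\<close> would occur four times; hence odd \<open>k\<close> starts at 3.\<close>

lemma balanced_array_exists_nat:
  assumes "k \<noteq> 1"
  shows "\<exists>M. balanced_array {..<8::nat} {..<4} k M"
  using assms
proof (induction k rule: less_induct)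
  case (less k)
  consider "k = 0" | "k = 3" | k' where "k = k' + 2" "k' \<noteq> 1"
  proof (cases "k = 0 \<or> k = 3")
    case False
    then show ?thesis
      using less.prems that(3)[of "k - 2"] by auto
  qed (use that in auto)
  then show ?case
  proof cases
    case 1
    then show ?thesis by (simp add: balanced_array_def)
  next
    case 2
    then show ?thesis using balanced_array_base by blast
  next
    case 3
    then obtain M where "balanced_array {..<8::nat} {..<4} k' M"
      using less.IH[of k'] by auto
    from balanced_array_step[OF this] show ?thesis
      unfolding 3 by blast
  qed
qed

text \<open>Bijections from \<open>P\<close> onto the first four rows and from its complement onto
  the last four glue to one that respects the prescribed row sums.\<close>

lemma balanced_array_exists:
  assumes "card V = 8" "P \<subseteq> V" "card P = 4" "k \<noteq> 1"
  shows "\<exists>M. balanced_array V P k M"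
proof -
  have fin: "finite V" using assms(1) by (simp add: card_ge_0_finite)
  then have "finite P" using assms(2) finite_subset by blast
  then obtain h1 where h1: "bij_betw h1 P {..<4::nat}"
    using assms(3) by (metis bij_betw_iff_card card_lessThan finite_lessThan)
  have "card (V - P) = card {4..<8::nat}"
    using assms \<open>finite P\<close> by (simp add: card_Diff_subset)
  then obtain h2 where h2: "bij_betw h2 (V - P) {4..<8::nat}"
    using fin by (metis bij_betw_iff_card finite_Diff finite_atLeastLessThan)
  define h where "h v = (if v \<in> P then h1 v else h2 v)" for v
  have "bij_betw h P {..<4}" "bij_betw h (V - P) {4..<8}"
    using h1 h2 bij_betw_cong[of P h h1] bij_betw_cong[of "V - P" h h2] by (simp_all add: h_def)
  from bij_betw_combine[OF this] have "bij_betw h V {..<8}"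
    using assms(2) by (simp add: Un_absorb1 ivl_disj_un lessThan_atLeast0)
  moreover have "h v \<in> {..<4} \<longleftrightarrow> v \<in> P" if "v \<in> V" for v
  proof (cases "v \<in> P")
    case True
    then show ?thesis using bij_betwE[OF h1] by (simp add: h_def)
  next
    case False
    then have "h2 v \<in> {4..<8}" using bij_betwE[OF h2] that by blast
    then show ?thesis using False by (simp add: h_def)
  qed
  moreover obtain M where "balanced_array {..<8::nat} {..<4} k M"
    using balanced_array_exists_nat[OF assms(4)] by blast
  ultimately show ?thesis
    using balanced_array_reindex by blast
qed

section \<open>Labelings of a join with an edgeless graph\<close>

lemma verts_join_edgeless: "verts (graph_join G (edgeless k)) = Inl ` verts G \<union> Inr ` {..<k}"
  by (auto simp: graph_join_def edgeless_def)

lemma edges_join_edgeless: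
  "edges (graph_join G (edgeless k)) =
     (`) Inl ` edges G \<union> (\<lambda>(u, j). {Inl u, Inr j}) ` (verts G \<times> {..<k})"
  by (auto simp: graph_join_def edgeless_def)

lemma finite_edges: "simple_graph G \<Longrightarrow> finite (edges G)"
  by (rule finite_subset[of _ "Pow (verts G)"]) (auto simp: simple_graph_def)

lemma inj_on_join_edge: "inj_on (\<lambda>(u, j). {Inl u, Inr j}) A"
  by (auto simp: inj_on_def doubleton_eq_iff)

lemma inj_on_image_Inl: "inj_on ((`) Inl) A"
  by (auto simp: inj_on_def inj_image_eq_iff)

lemma Inr_vimage_Inl_image: "Inr -` Inl ` e = {}"
  by auto

lemma Inl_vimage_Inl_image: "Inl -` Inl ` e = e"
  by auto

lemma vimage_join_edge: "Inl -` {Inl u, Inr j} = {u}" "Inr -` {Inl u, Inr j} = {j}"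
  by auto

lemma card_edges_join_edgeless:
  assumes "simple_graph G"
  shows "card (edges (graph_join G (edgeless k))) = card (edges G) + card (verts G) * k"
proof -
  have "(`) Inl ` edges G \<inter> (\<lambda>(u, j). {Inl u, Inr j}) ` (verts G \<times> {..<k}) = {}"
    by auto
  moreover have "finite (verts G)" using assms by (simp add: simple_graph_def)
  ultimately show ?thesis
    using finite_edges[OF assms]
    by (simp add: edges_join_edgeless card_Un_disjoint card_image inj_on_join_edge
        inj_on_image_Inl card_cartesian_product)
qed

text \<open>Preimages decode an edge: one without an endpoint in the edgeless part comes from the
  first graph; for a cross edge both preimages are singletons, read off by
  \<open>the_elem\<close>.\<close>

definition join_label :: "('a set \<Rightarrow> nat) \<Rightarrow> ('a \<Rightarrow> 'b \<Rightarrow> nat) \<Rightarrow> ('a + 'b) set \<Rightarrow> nat" where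
  "join_label g F e =
     (if Inr -` e = {} then g (Inl -` e) else F (the_elem (Inl -` e)) (the_elem (Inr -` e)))"

lemma join_label_Inl: "join_label g F (Inl ` e) = g e"
  by (simp add: join_label_def Inr_vimage_Inl_image Inl_vimage_Inl_image)

lemma join_label_cross: "join_label g F {Inl u, Inr j} = F u j"
  by (simp add: join_label_def vimage_join_edge)

lemma vertex_sum_join_label_Inl:
  assumes "simple_graph G" "u \<in> verts G"
  shows "vertex_sum (graph_join G (edgeless k)) (join_label g F) (Inl u) =
           vertex_sum G g u + (\<Sum>j<k. F u j)"
proof -
  have "{e \<in> edges (graph_join G (edgeless k)). Inl u \<in> e} =
          (`) Inl ` {e \<in> edges G. u \<in> e} \<union> (\<lambda>j. {Inl u, Inr j}) ` {..<k}"
    using assms(2) by (auto simp: edges_join_edgeless)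
  moreover have "(`) Inl ` {e \<in> edges G. u \<in> e} \<inter> (\<lambda>j. {Inl u, Inr j}) ` {..<k} = {}"
    by auto
  moreover have "inj_on (\<lambda>j. {Inl u, Inr j}) {..<k}"
    by (auto simp: inj_on_def doubleton_eq_iff)
  ultimately show ?thesis
    using finite_edges[OF assms(1)]
    by (simp add: vertex_sum_def sum.union_disjoint sum.reindex inj_on_image_Inl
        join_label_Inl join_label_cross)
qed

lemma vertex_sum_join_label_Inr:
  assumes "j < k"
  shows "vertex_sum (graph_join G (edgeless k)) (join_label g F) (Inr j) = (\<Sum>u\<in>verts G. F u j)"
proof -
  have "{e \<in> edges (graph_join G (edgeless k)). Inr j \<in> e} = (\<lambda>u. {Inl u, Inr j}) ` verts G"
    using assms by (auto simp: edges_join_edgeless)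
  moreover have "inj_on (\<lambda>u. {Inl u, Inr j}) (verts G)"
    by (auto simp: inj_on_def doubleton_eq_iff)
  ultimately show ?thesis
    by (simp add: vertex_sum_def sum.reindex join_label_cross)
qed

text \<open>The two kinds of edges use disjoint label ranges, so injectivity can be checked on each
  kind; surjectivity then follows by counting.\<close>

lemma bij_betw_join_label:
  assumes G: "simple_graph G" and g: "bij_betw g (edges G) {1..card (edges G)}"
    and inj: "inj_on (\<lambda>(u, j). F u j) (verts G \<times> {..<k})"
    and rng: "\<And>u j. u \<in> verts G \<Longrightarrow> j < k \<Longrightarrow>
       F u j \<in> {card (edges G) <.. card (edges G) + card (verts G) * k}"
  shows "bij_betw (join_label g F) (edges (graph_join G (edgeless k)))
           {1..card (edges (graph_join G (edgeless k)))}"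
proof -
  let ?E = "edges (graph_join G (edgeless k))"
  have gr: "g e \<in> {1..card (edges G)}" if "e \<in> edges G" for e
    using g that by (auto simp: bij_betw_def)
  have ginj: "inj_on g (edges G)" using g by (simp add: bij_betw_def)
  have "inj_on (join_label g F) ?E"
    unfolding edges_join_edgeless inj_on_Un
  proof (intro conjI)
    show "inj_on (join_label g F) ((`) Inl ` edges G)"
      using ginj by (auto simp: inj_on_def join_label_Inl)
    show "inj_on (join_label g F) ((\<lambda>(u, j). {Inl u, Inr j}) ` (verts G \<times> {..<k}))"
      by (rule inj_on_imageI) (use inj in \<open>simp add: comp_def case_prod_unfold join_label_cross\<close>)
    show "join_label g F ` ((`) Inl ` edges G - (\<lambda>(u, j). {Inl u, Inr j}) ` (verts G \<times> {..<k})) \<inter>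
        join_label g F ` ((\<lambda>(u, j). {Inl u, Inr j}) ` (verts G \<times> {..<k}) - (`) Inl ` edges G) = {}"
      using gr rng by (fastforce simp: join_label_Inl join_label_cross)
  qed
  moreover have "join_label g F ` ?E \<subseteq> {1..card ?E}"
  proof -
    have "join_label g F e \<in> {1..card (edges G) + card (verts G) * k}" if "e \<in> ?E" for e
      using that unfolding edges_join_edgeless
    proof (elim UnE imageE)
      fix d assume "e = Inl ` d" "d \<in> edges G"
      then show ?thesis using gr[of d] by (simp add: join_label_Inl)
    next
      fix p assume "e = (case p of (u, j) \<Rightarrow> {Inl u, Inr j})" "p \<in> verts G \<times> {..<k}"
      then show ?thesis using rng[of "fst p" "snd p"] by (auto simp: join_label_cross)
    qed
    then show ?thesis by (auto simp: card_edges_join_edgeless[OF G])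
  qed
  ultimately show ?thesis
    by (simp add: bij_betw_def card_image card_subset_eq)
qed

section \<open>Upper and lower bounds for the join with an edgeless graph\<close>

lemma chi_la_le:
  assumes "local_antimagic G f"
  shows "chi_la G \<le> enat (card (vertex_sum G f ` verts G))"
  unfolding chi_la_def using assms by (auto intro: INF_lower)

text \<open>The cross edges receive the labels \<open>(2m + 8k + 1 + x) / 2\<close> with \<open>x\<close> running through a balanced
  array, so every vertex of the edgeless part has sum \<open>4 (2m + 8k + 1)\<close>, and the sums at two vertices
  of \<open>G\<close> differ as under \<open>g\<close> up to an error of at most one, which vanishes if both or neither lie
  in \<open>P\<close>. The bounds on \<open>vertex_sum G g\<close> keep the sums of the two parts apart; for \<open>k = 7\<close> this
  excludes precisely two values.\<close>

lemma chi_la_join_edgeless_le: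
  fixes G :: "'a graph"
  assumes G: "simple_graph G" and V: "card (verts G) = 8" and k: "k \<ge> 3"
    and m: "card (edges G) = m" and g: "bij_betw g (edges G) {1..m}"
    and P: "P \<subseteq> verts G" "card P = 4"
    and adj: "\<And>u v. {u, v} \<in> edges G \<Longrightarrow>
       vertex_sum G g u + 2 \<le> vertex_sum G g v \<or> vertex_sum G g v + 2 \<le> vertex_sum G g u"
    and rng: "\<And>v. v \<in> verts G \<Longrightarrow>
       vertex_sum G g v \<in> {1..2 * m + 48} - {m + 28, m + 29}"
    and colors: "card ((\<lambda>v. (vertex_sum G g v, v \<in> P)) ` verts G) \<le> c"
  shows "chi_la (graph_join G (edgeless k)) \<le> enat (Suc c)"
proof -
  let ?J = "graph_join G (edgeless k)"
  let ?t = "2 * int m + 8 * int k + 1"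
  obtain M where M: "balanced_array (verts G) P k M"
    using balanced_array_exists[OF V P] k by (metis numeral_One numeral_le_iff semiring_norm(70))
  define F where "F u j = nat ((?t + M u j) div 2)" for u j
  define f where "f = join_label g F"
  have Mb: "odd (M u j)" "\<bar>M u j\<bar> < 8 * int k" if "u \<in> verts G" "j < k" for u j
    using M that by (auto simp: balanced_array_def)
  \<comment> \<open>Both \<open>?t\<close> and \<open>M u j\<close> are odd, so halving is exact;
    \<open>?t\<close> exceeds \<open>8 * k\<close>, so \<open>nat\<close> truncates nothing.\<close>
  have F: "2 * int (F u j) = ?t + M u j" if "u \<in> verts G" "j < k" for u j
    using Mb[OF that] by (auto simp: F_def elim!: oddE)
  have "inj_on (\<lambda>(u, j). F u j) (verts G \<times> {..<k})"
  proof (rule inj_onI, unfold split_paired_all mem_Sigma_iff prod.inject case_prod_conv, elim conjE)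
    fix u i v j
    assume *: "u \<in> verts G" "v \<in> verts G" "i \<in> {..<k}" "j \<in> {..<k}" "F u i = F v j"
    then have "M u i = M v j"
      using F[of u i] F[of v j] by simp
    moreover have "inj_on (\<lambda>(v, j). M v j) (verts G \<times> {..<k})"
      using M by (simp add: balanced_array_def)
    from inj_onD[OF this, of "(u, i)" "(v, j)"] calculation * show "u = v \<and> i = j"
      by simp
  qed
  moreover have "F u j \<in> {m<..m + card (verts G) * k}" if "u \<in> verts G" "j < k" for u j
    using F[OF that] Mb[OF that] V by auto
  ultimately have bij: "bij_betw f (edges ?J) {1..card (edges ?J)}"
    unfolding f_def using bij_betw_join_label[OF G] g m by blast
  define R :: "'a \<Rightarrow> int" where "R v = (if even k then 0 else if v \<in> P then 1 else -1)" for v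
  have sum_Inl: "2 * int (vertex_sum ?J f (Inl v)) = 2 * int (vertex_sum G g v) + int k * ?t + R v"
    if "v \<in> verts G" for v
  proof -
    have "2 * (\<Sum>j<k. int (F v j)) = (\<Sum>j<k. ?t + M v j)"
      using F[OF that] by (simp add: sum_distrib_left)
    also have "\<dots> = int k * ?t + R v"
      using M that by (simp add: sum.distrib balanced_array_def R_def)
    finally show ?thesis
      using that by (simp add: f_def vertex_sum_join_label_Inl[OF G])
  qed
  have sum_Inr: "2 * int (vertex_sum ?J f (Inr j)) = 8 * ?t" if "j < k" for j
  proof -
    have "2 * (\<Sum>v\<in>verts G. int (F v j)) = (\<Sum>v\<in>verts G. ?t + M v j)"
      using F[OF _ that] by (simp add: sum_distrib_left)
    also have "\<dots> = 8 * ?t"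
      using M that V by (simp add: sum.distrib balanced_array_def)
    finally show ?thesis
      using that by (simp add: f_def vertex_sum_join_label_Inr)
  qed
  have R: "\<bar>R v\<bar> \<le> 1" for v
    by (simp add: R_def)
  have cross: "vertex_sum ?J f (Inl v) \<noteq> vertex_sum ?J f (Inr j)" if "v \<in> verts G" "j < k" for v j
  proof
    assume "vertex_sum ?J f (Inl v) = vertex_sum ?J f (Inr j)"
    then have eq: "2 * int (vertex_sum G g v) + R v = (8 - int k) * ?t"
      using sum_Inl[OF that(1)] sum_Inr[OF that(2)] by (simp add: algebra_simps)
    \<comment> \<open>For \<open>k \<ge> 8\<close> the right side is at most 0, the left side at
      least 1. For \<open>k = 7\<close> the right side is \<open>2 * m + 57\<close> and
      \<open>R v\<close> is \<open>1\<close> or \<open>-1\<close>, which gives the excluded sums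
      \<open>m + 28\<close> and \<open>m + 29\<close>. For smaller \<open>k\<close> the right side
      is too large; the tightest case is \<open>k = 6\<close>, where it equals
      \<open>4 * m + 98\<close>, whence the bound \<open>2 * m + 48\<close>.\<close>
    consider "k = 3" | "k = 4" | "k = 5" | "k = 6" | "k = 7" | "k \<ge> 8"
      using k by linarith
    then show False
    proof cases
      case 6
      then have "(8 - int k) * ?t \<le> 0"
        by (simp add: mult_nonpos_nonneg)
      then show False
        using eq rng[OF that(1)] R[of v] by simp
    next
      case 5
      then show False
        using eq rng[OF that(1)] by (auto simp: R_def split: if_splits)
    qed (use eq rng[OF that(1)] R[of v] in simp_all)
  qed
  have "vertex_sum ?J f x \<noteq> vertex_sum ?J f y" if "{x, y} \<in> edges ?J" for x y
  proof -
    have "(\<exists>u v. x = Inl u \<and> y = Inl v \<and> {u, v} \<in> edges G) \<or>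
          (\<exists>v j. v \<in> verts G \<and> j < k \<and> (x = Inl v \<and> y = Inr j \<or> x = Inr j \<and> y = Inl v))"
      using that unfolding edges_join_edgeless
    proof (elim UnE)
      assume "{x, y} \<in> (`) Inl ` edges G"
      then obtain e where e: "{x, y} = Inl ` e" "e \<in> edges G" by auto
      then obtain u v where "x = Inl u" "y = Inl v" by blast
      with e have "(Inl :: 'a \<Rightarrow> 'a + nat) ` {u, v} = Inl ` e" by simp
      then have "{u, v} = e" by (simp only: inj_image_eq_iff[OF inj_Inl])
      then show ?thesis using e \<open>x = Inl u\<close> \<open>y = Inl v\<close> by blast
    next
      assume "{x, y} \<in> (\<lambda>(u, j). {Inl u, Inr j}) ` (verts G \<times> {..<k})"
      then obtain v j where "v \<in> verts G" "j < k" "{x, y} = {Inl v, Inr j}" by auto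
      then show ?thesis by (metis doubleton_eq_iff)
    qed
    then show ?thesis
    proof (elim disjE exE conjE)
      fix u v assume *: "x = Inl u" "y = Inl v" "{u, v} \<in> edges G"
      then have "u \<in> verts G" "v \<in> verts G"
        using G by (auto simp: simple_graph_def)
      \<comment> \<open>The doubled sums under \<open>g\<close> differ by at least 4, and the
        \<open>R\<close> terms change this difference by at most 2.\<close>
      then show ?thesis
        using sum_Inl[of u] sum_Inl[of v] adj[OF *(3)] R[of u] R[of v] * by auto
    qed (use cross in \<open>auto dest: sym\<close>)
  qed
  with bij have "local_antimagic ?J f"
    by (simp add: local_antimagic_def)
  then have "chi_la ?J \<le> enat (card (vertex_sum ?J f ` verts ?J))"
    by (rule chi_la_le)
  also have "card (vertex_sum ?J f ` verts ?J) \<le> Suc c"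
  proof -
    let ?K = "(\<lambda>v. (vertex_sum G g v, v \<in> P)) ` verts G"
    \<comment> \<open>The sum at a vertex of \<open>G\<close> depends only on its sum under
      \<open>g\<close> and on membership in \<open>P\<close>, so these pairs bound the number of
      colors on \<open>G\<close>; the edgeless part adds a single one.\<close>
    define \<phi> where "\<phi> = (\<lambda>(s, p). nat ((2 * int s + int k * ?t +
       (if even k then 0 else if p then 1 else -1)) div 2))"
    have fin: "finite ?K" using G by (simp add: simple_graph_def)
    have "vertex_sum ?J f (Inl v) = \<phi> (vertex_sum G g v, v \<in> P)" if "v \<in> verts G" for v
      using sum_Inl[OF that] unfolding \<phi>_def R_def by simp
    moreover have "vertex_sum ?J f (Inr j) = nat (4 * ?t)" if "j < k" for j
      using sum_Inr[OF that] by simp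
    ultimately have sub: "vertex_sum ?J f ` verts ?J \<subseteq> insert (nat (4 * ?t)) (\<phi> ` ?K)"
      by (auto simp: verts_join_edgeless)
    have "card (vertex_sum ?J f ` verts ?J) \<le> card (insert (nat (4 * ?t)) (\<phi> ` ?K))"
      by (rule card_mono[OF _ sub]) (use fin in simp)
    also have "\<dots> \<le> Suc (card (\<phi> ` ?K))"
      by (rule card_insert_le_m1) auto
    also have "card (\<phi> ` ?K) \<le> c"
      using card_image_le[OF fin, of \<phi>] colors by linarith
    finally show ?thesis by simp
  qed
  finally show ?thesis by simp
qed

text \<open>Adjacent vertices have different sums, so without three independent vertices each value
  occurs at most twice on \<open>G\<close>. A vertex of the edgeless part is adjacent to all of
  \<open>G\<close> and needs a further value.\<close>

lemma chi_la_join_edgeless_ge: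
  fixes G :: "'a graph"
  assumes G: "simple_graph G" and k: "k > 0"
    and alpha: "\<And>u v w. {u, v, w} \<subseteq> verts G \<Longrightarrow> u \<noteq> v \<Longrightarrow> u \<noteq> w \<Longrightarrow> v \<noteq> w \<Longrightarrow>
       {u, v} \<in> edges G \<or> {u, w} \<in> edges G \<or> {v, w} \<in> edges G"
    and c: "2 * c \<le> card (verts G)"
  shows "enat (Suc c) \<le> chi_la (graph_join G (edgeless k))"
  unfolding chi_la_def
proof (rule INF_greatest, simp only: mem_Collect_eq enat_ord_simps)
  let ?J = "graph_join G (edgeless k)"
  fix f assume f: "local_antimagic ?J f"
  let ?s = "\<lambda>v. vertex_sum ?J f (Inl v)"
  have fin: "finite (verts G)" using G by (simp add: simple_graph_def)
  have adj: "?s u \<noteq> ?s v" if "{u, v} \<in> edges G" for u v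
  proof -
    have "{Inl u, Inl v} \<in> edges ?J"
      using imageI[OF that, of "(`) (Inl :: 'a \<Rightarrow> 'a + nat)"]
      by (simp only: edges_join_edgeless image_insert image_empty UnI1)
    then show ?thesis using f by (simp add: local_antimagic_def)
  qed
  have fibre: "card {v \<in> verts G. ?s v = y} \<le> 2" for y
  proof (rule ccontr)
    assume "\<not> ?thesis"
    then have "3 \<le> card {v \<in> verts G. ?s v = y}" by simp
    then obtain T where "T \<subseteq> {v \<in> verts G. ?s v = y}" "card T = 3"
      by (meson obtain_subset_with_card_n)
    then obtain u v w where "{u, v, w} \<subseteq> {v \<in> verts G. ?s v = y}" "u \<noteq> v" "v \<noteq> w" "u \<noteq> w"
      by (auto simp: card_3_iff)
    then show False
      using alpha[of u v w] adj[of u v] adj[of u w] adj[of v w] by auto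
  qed
  have "card (verts G) = (\<Sum>y\<in>?s ` verts G. card {v \<in> verts G. ?s v = y})"
    using sum.image_gen[OF fin, of "\<lambda>_. 1::nat" ?s] by simp
  also have "\<dots> \<le> (\<Sum>y\<in>?s ` verts G. 2)"
    by (rule sum_mono) (rule fibre)
  finally have "c \<le> card (?s ` verts G)"
    using c by simp
  moreover have "vertex_sum ?J f (Inr 0) \<notin> ?s ` verts G"
  proof
    assume "vertex_sum ?J f (Inr 0) \<in> ?s ` verts G"
    then obtain v where v: "v \<in> verts G" "?s v = vertex_sum ?J f (Inr 0)" by auto
    then have "{Inl v, Inr 0} \<in> edges ?J"
      using k by (auto simp: edges_join_edgeless)
    then show False
      using f v by (auto simp: local_antimagic_def)
  qed
  ultimately have "Suc c \<le> card (insert (vertex_sum ?J f (Inr 0)) (?s ` verts G))"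
    using fin by simp
  also have "\<dots> \<le> card (vertex_sum ?J f ` verts ?J)"
    by (rule card_mono) (use fin k in \<open>auto simp: verts_join_edgeless\<close>)
  finally show "Suc c \<le> card (vertex_sum ?J f ` verts ?J)" .
qed

section \<open>Circulant graphs of order eight\<close>

text \<open>Executable counterpart of a vertex sum: the label of an edge is its position in
  \<open>ps\<close>, counted from 1.\<close>

definition list_weight :: "(int \<times> int) list \<Rightarrow> int \<Rightarrow> nat" where
  "list_weight ps u = (\<Sum>(l, i, j)\<leftarrow>List.enumerate 1 ps. if u = i \<or> u = j then l else 0)"

text \<open>The labeling inverts the map from positions to edges; ordering each pair upwards ensures
  that distinct list entries are distinct edges.\<close>

lemma labeling_of_list:
  assumes "distinct ps" "\<And>i j. (i, j) \<in> set ps \<Longrightarrow> i < j"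
    and E: "edges G = (\<lambda>(i, j). {i, j}) ` set ps"
  shows "\<exists>g. bij_betw g (edges G) {1..length ps} \<and> (\<forall>u. vertex_sum G g u = list_weight ps u)"
proof -
  \<comment> \<open>Labels start at 1, list indices at 0.\<close>
  define h where "h l = (case ps ! (l - 1) of (i, j) \<Rightarrow> {i, j})" for l
  have inj: "inj_on (\<lambda>(i, j). {i, j}) (set ps)"
    using assms(2) by (auto simp: inj_on_def doubleton_eq_iff) (metis less_asym)+
  have "bij_betw (\<lambda>l. l - 1) {1..length ps} {..<length ps}"
    by (rule bij_betw_byWitness[where f' = Suc]) auto
  from bij_betw_trans[OF this bij_betw_nth[OF assms(1) refl refl]]
  have "bij_betw (\<lambda>l. ps ! (l - 1)) {1..length ps} (set ps)"
    by (simp add: comp_def)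
  from bij_betw_trans[OF this inj_on_imp_bij_betw[OF inj]]
  have h: "bij_betw h {1..length ps} (edges G)"
    by (simp add: comp_def h_def[abs_def] E)
  define g where "g = inv_into {1..length ps} h"
  have gh: "g (h l) = l" if "l \<in> {1..length ps}" for l
    unfolding g_def using h that by (simp add: bij_betw_inv_into_left)
  have g: "bij_betw g (edges G) {1..length ps}"
    unfolding g_def by (rule bij_betw_inv_into[OF h])
  have "vertex_sum G g u = list_weight ps u" for u
  proof -
    have "vertex_sum G g u = (\<Sum>e\<in>edges G. if u \<in> e then g e else 0)"
      unfolding vertex_sum_def
      using bij_betw_finite[OF h] by (subst sum.inter_filter) auto
    also have "\<dots> = (\<Sum>l\<in>{1..length ps}. if u \<in> h l then g (h l) else 0)"
      by (rule sum.reindex_bij_betw[OF h, symmetric])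
    also have "\<dots> = (\<Sum>l\<in>{1..length ps}. if u \<in> h l then l else 0)"
      by (rule sum.cong) (auto simp: gh)
    also have "\<dots> = (\<Sum>l<length ps. if u \<in> h (Suc l) then Suc l else 0)"
      by (simp add: sum.atLeast1_atMost_eq)
    also have "\<dots> = list_weight ps u"
      by (simp add: list_weight_def sum_list_sum_nth nth_enumerate_eq h_def atLeast0LessThan
          case_prod_beta cong: if_cong)
    finally show ?thesis .
  qed
  then show ?thesis using g by blast
qed

text \<open>Listing each edge with its smaller endpoint first makes the edge set computable;
  positivity of \<open>D\<close> rules out loops, whose cyclic distance is 0.\<close>

lemma circulant_8_eq:
  assumes "\<And>d. d \<in> D \<Longrightarrow> d > 0"
  shows "edges (circulant 8 D) = (\<lambda>(i, j). {i, j}) `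
    set (filter (\<lambda>(i, j). i < j \<and> cyclic_dist 8 i j \<in> D) (List.product [0..7] [0..7]))"
    (is "?L = ?R")
proof
  show "?R \<subseteq> ?L"
    by (fastforce simp: circulant_def)
  show "?L \<subseteq> ?R"
  proof
    fix e assume "e \<in> ?L"
    then obtain i j where e: "e = {i, j}" "i \<in> {0..<8}" "j \<in> {0..<8}" "cyclic_dist 8 i j \<in> D"
      by (auto simp: circulant_def)
    have "i \<noteq> j"
      using assms[OF e(4)] e by (auto simp: cyclic_dist_def)
    then show "e \<in> ?R"
    proof (cases "i < j")
      case True
      then show ?thesis using e by (intro image_eqI[of _ _ "(i, j)"]) auto
    next
      case False
      have "cyclic_dist 8 j i \<in> D" using e by (simp add: cyclic_dist_def abs_minus_commute)
      then show ?thesis using e False \<open>i \<noteq> j\<close> by (intro image_eqI[of _ _ "(j, i)"]) auto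
    qed
  qed
qed

text \<open>All hypotheses below are decidable by evaluation, \<open>ps\<close> being the edge list in the order of
  the labels.\<close>

lemma chi_la_circulant_8_join_le:
  assumes "\<forall>d\<in>set D. d > 0" "k \<ge> 3" "distinct ps" "distinct Q" "length Q = 4" "set Q \<subseteq> set [0..7]"
    and ps: "set (filter (\<lambda>(i, j). i < j \<and> cyclic_dist 8 i j \<in> set D) (List.product [0..7] [0..7])) = set ps"
    and adj: "\<forall>(i, j)\<in>set ps. i < j \<and> (list_weight ps i + 2 \<le> list_weight ps j \<or>
       list_weight ps j + 2 \<le> list_weight ps i)"
    and rng: "\<forall>v\<in>set [0..7]. let s = list_weight ps v; m = length ps in
       1 \<le> s \<and> s \<le> 2 * m + 48 \<and> s \<noteq> m + 28 \<and> s \<noteq> m + 29"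
    and colors: "length (remdups (map (\<lambda>v. (list_weight ps v, v \<in> set Q)) [0..7])) \<le> c"
  shows "chi_la (graph_join (circulant 8 (set D)) (edgeless k)) \<le> enat (Suc c)"
proof -
  let ?G = "circulant 8 (set D)"
  have E: "edges ?G = (\<lambda>(i, j). {i, j}) ` set ps"
    using circulant_8_eq[of "set D"] assms(1) unfolding ps by blast
  have V: "verts ?G = set [0..7]" by (auto simp: circulant_def)
  obtain g where g: "bij_betw g (edges ?G) {1..length ps}"
    and w: "vertex_sum ?G g = list_weight ps"
    using labeling_of_list[of ps ?G] assms(3) adj E by (metis (no_types, lifting) case_prodD ext)
  show ?thesis
  proof (rule chi_la_join_edgeless_le[OF _ _ assms(2) _ g, where P = "set Q"])
    show "simple_graph ?G" using assms(1) by (intro simple_graph_circulant) auto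
    show "card (verts ?G) = 8" by (simp add: circulant_def)
    show "card (edges ?G) = length ps" using bij_betw_same_card[OF g] by simp
    show "set Q \<subseteq> verts ?G" using assms(6) V by simp
    show "card (set Q) = 4" using assms(4,5) distinct_card by metis
    show "vertex_sum ?G g u + 2 \<le> vertex_sum ?G g v \<or> vertex_sum ?G g v + 2 \<le> vertex_sum ?G g u"
      if "{u, v} \<in> edges ?G" for u v
    proof -
      from that obtain i j where "(i, j) \<in> set ps" "{u, v} = {i, j}" unfolding E by auto
      then show ?thesis using adj unfolding w by (auto simp: doubleton_eq_iff)
    qed
    show "vertex_sum ?G g v \<in> {1..2 * length ps + 48} - {length ps + 28, length ps + 29}"
      if "v \<in> verts ?G" for v
      using rng that unfolding w V Let_def by simp
    show "card ((\<lambda>v. (vertex_sum ?G g v, v \<in> set Q)) ` verts ?G) \<le> c"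
      unfolding w V using colors by (metis (no_types, lifting) length_remdups_card_conv set_map)
  qed
qed

section \<open>The value 5 for the three circulant graphs\<close>

lemma chi_la_circulant_8_join:
  assumes "D \<in> {{1, 2, 4}, {1, 3, 4}, {1, 2, 3}}" "k \<ge> 3"
  shows "chi_la (graph_join (circulant 8 D) (edgeless k)) = 5"
proof (rule antisym)
  \<comment> \<open>The sums are 46 on \<open>{0, 3}\<close>, 51 on \<open>{1, 6}\<close>, 55 on
    \<open>{4, 7}\<close> and 58 on \<open>{2, 5}\<close>; \<open>Q\<close> unites two of these
    pairs, so recording membership in \<open>Q\<close> splits none of them.\<close>
  have "chi_la (graph_join (circulant 8 (set [1, 2, 4])) (edgeless k)) \<le> enat (Suc 4)"
    by (rule chi_la_circulant_8_join_le[OF _ assms(2), where Q = "[0, 3, 1, 6]" and ps =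
        "[(2, 6), (0, 4), (3, 5), (0, 7), (1, 3), (4, 6), (2, 3), (5, 7), (0, 6), (1, 7),
          (0, 1), (1, 2), (1, 5), (3, 4), (4, 5), (6, 7), (3, 7), (2, 4), (5, 6), (0, 2)]"];
        code_simp)
  \<comment> \<open>The same four sums, now on \<open>{0, 2}\<close>, \<open>{4, 6}\<close>,
    \<open>{1, 3}\<close> and \<open>{5, 7}\<close> in this order.\<close>
  moreover have "chi_la (graph_join (circulant 8 (set [1, 3, 4])) (edgeless k)) \<le> enat (Suc 4)"
    by (rule chi_la_circulant_8_join_le[OF _ assms(2), where Q = "[0, 2, 4, 6]" and ps =
        "[(3, 6), (2, 7), (1, 4), (1, 2), (0, 3), (0, 5), (0, 7), (5, 6), (0, 4), (2, 6),
          (4, 7), (1, 6), (4, 5), (2, 5), (3, 4), (2, 3), (1, 5), (3, 7), (0, 1), (6, 7)]"];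
        code_simp)
  \<comment> \<open>The sums are 70, 73, 77 and 80 on the antipodal pairs \<open>{0, 4}\<close>,
    \<open>{1, 5}\<close>, \<open>{2, 6}\<close> and \<open>{3, 7}\<close>.\<close>
  moreover have "chi_la (graph_join (circulant 8 (set [1, 2, 3])) (edgeless k)) \<le> enat (Suc 4)"
    by (rule chi_la_circulant_8_join_le[OF _ assms(2), where Q = "[0, 4, 1, 5]" and ps =
        "[(4, 6), (2, 4), (0, 5), (0, 1), (1, 6), (6, 7), (0, 3), (3, 5), (2, 7), (5, 7), (1, 7), (4, 5),
          (0, 2), (3, 4), (1, 3), (2, 5), (2, 3), (1, 4), (3, 6), (1, 2), (0, 7), (0, 6), (4, 7), (5, 6)]"];
        code_simp)
  ultimately show "chi_la (graph_join (circulant 8 D) (edgeless k)) \<le> 5"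
    using assms(1) by (auto simp: numeral_eq_enat)
  have "enat (Suc 4) \<le> chi_la (graph_join (circulant 8 D) (edgeless k))"
  proof (rule chi_la_join_edgeless_ge)
    show "simple_graph (circulant 8 D)"
      using assms(1) by (intro simple_graph_circulant) auto
    show "k > 0" using assms(2) by simp
    show "2 * 4 \<le> card (verts (circulant 8 D))" by (simp add: circulant_def)
    fix u v w :: int
    assume *: "{u, v, w} \<subseteq> verts (circulant 8 D)" "u \<noteq> v" "u \<noteq> w" "v \<noteq> w"
    then have uvw: "u \<in> {0..<8}" "v \<in> {0..<8}" "w \<in> {0..<8}"
      by (auto simp: circulant_def)
    \<comment> \<open>Independence number at most 2, by testing all triples of vertices.\<close>
    have "\<forall>D\<in>set [{1, 2, 4}, {1, 3, 4}, {1, 2, 3}]. \<forall>u\<in>set [0..7]. \<forall>v\<in>set [0..7]. \<forall>w\<in>set [0..7].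
        u \<noteq> v \<longrightarrow> u \<noteq> w \<longrightarrow> v \<noteq> w \<longrightarrow>
        cyclic_dist 8 u v \<in> D \<or> cyclic_dist 8 u w \<in> D \<or> cyclic_dist 8 v w \<in> D"
      by code_simp
    moreover have "D \<in> set [{1, 2, 4}, {1, 3, 4}, {1, 2, 3}]"
      using assms(1) by simp
    moreover have "u \<in> set [0..7]" "v \<in> set [0..7]" "w \<in> set [0..7]"
      using uvw by auto
    ultimately have "cyclic_dist 8 u v \<in> D \<or> cyclic_dist 8 u w \<in> D \<or> cyclic_dist 8 v w \<in> D"
      using * by blast
    then show "{u, v} \<in> edges (circulant 8 D) \<or> {u, w} \<in> edges (circulant 8 D) \<or>
        {v, w} \<in> edges (circulant 8 D)"
      using uvw by (auto simp: circulant_def)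
  qed
  then show "5 \<le> chi_la (graph_join (circulant 8 D) (edgeless k))"
    by (simp add: numeral_eq_enat)
qed

theorem theorem3p14:
  fixes G :: "int graph" and k :: nat
  assumes "G \<in> {circulant 8 {1, 2, 4}, circulant 8 {1, 3, 4}, circulant 8 {1, 2, 3}}"
    and "k \<ge> 3"
  shows "chi_la (graph_join G (edgeless k)) = 5"
  using assms chi_la_circulant_8_join by blast

end
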